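(* Let $c$, $k$ and $\alpha$ be nonnegative real numbers with $c \le k$. Let $R_2(c,k;\alpha)$ denote the two-color off-diagonal continuous Rado number on $[\alpha,\infty)$ of the pair of equations $x+y+c=z$ (red) and $x+y+k=z$ (blue), i.e. the smallest real number $N \ge \alpha$ such that every red--blue coloring of the real interval $[\alpha,N]$ contains either a red solution to $x+y+c=z$ or a blue solution to $x+y+k=z$ (infinite if no such $N$ exists). Then \[ R_2(c,k;\alpha) = \begin{cases} k+3c+5\alpha, & \text{if } k \le 2c+\alpha,\\ 2k+c+4\alpha, & \text{if } k > 2c+\alpha. \end{cases} \]
   Context: A red--blue coloring of a set $S$ is an arbitrary function $S \to \{\text{red},\text{blue}\}$. Given a red--blue coloring of the real interval $[\alpha,N]$, a red solution to $x+y+c=z$ is a triple $(x,y,z)$ of real numbers in $[\alpha,N]$, all colored red, with $x+y+c=z$; a blue solution to $x+y+k=z$ is a triple $(x,y,z)$ of real numbers in $[\alpha,N]$, all colored blue, with $x+y+k=z$. The values $x,y,z$ are not required to be distinct (in particular $x=y$ is allowed). *)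

theory Defs
  imports Complex_Main "HOL-Library.Extended_Real"
begin

datatype color = Red | Blue

text \<open>A coloring of the interval \<open>{\<alpha>..N}\<close> is represented by a total function on the reals; only
  its values on the interval matter, since solutions are required to lie there.\<close>

definition mono_solution ::
    "(real \<Rightarrow> color) \<Rightarrow> color \<Rightarrow> real set \<Rightarrow> real \<Rightarrow> real \<times> real \<times> real \<Rightarrow> bool" where
  "mono_solution f col S c = (\<lambda>(x, y, z).
     x \<in> S \<and> y \<in> S \<and> z \<in> S \<and> f x = col \<and> f y = col \<and> f z = col \<and> x + y + c = z)"

definition rado_forcing :: "real \<Rightarrow> real \<Rightarrow> real \<Rightarrow> real \<Rightarrow> bool" where
  "rado_forcing c k \<alpha> N \<longleftrightarrow>
     (\<forall>f. (\<exists>t. mono_solution f Red {\<alpha>..N} c t) \<or> (\<exists>t. mono_solution f Blue {\<alpha>..N} k t))"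

definition is_rado_min :: "real \<Rightarrow> real \<Rightarrow> real \<Rightarrow> real \<Rightarrow> bool" where
  "is_rado_min c k \<alpha> N \<longleftrightarrow>
     N \<ge> \<alpha> \<and> rado_forcing c k \<alpha> N \<and> (\<forall>M\<ge>\<alpha>. rado_forcing c k \<alpha> M \<longrightarrow> N \<le> M)"

text \<open>The value is finite only if the minimum is attained; in particular an infimum that is not
  attained does not count as a Rado number.\<close>

definition R\<^sub>2 :: "real \<Rightarrow> real \<Rightarrow> real \<Rightarrow> ereal" where
  "R\<^sub>2 c k \<alpha> =
     (if \<exists>N. is_rado_min c k \<alpha> N then ereal (THE N. is_rado_min c k \<alpha> N) else \<infinity>)"

end

theory Submission
  imports Defs
begin

text \<open>Write \<open>p = k + 3c + 5\<alpha>\<close> and \<open>q = 2k + c + 4\<alpha>\<close>. Since \<open>p - q = \<alpha> + 2c - k\<close>, the claimed value is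
  \<open>max p q\<close>, and the proof establishes this more symmetric form.
  Below, the sum of two red points \<open>x\<close>, \<open>y\<close> means \<open>x + y + c\<close>, that of two blue points \<open>x + y + k\<close>,
  and differences and halves are meant accordingly.

  Lower bound: each of \<open>p\<close> and \<open>q\<close> has an extremal coloring, built greedily from the left. Starting
  with red, one stays red until \<open>2\<alpha> + c\<close>, the smallest sum of two red points; then stays blue until
  \<open>4\<alpha> + 2c + k\<close>, the smallest sum of two blue points; then is red again, and red sums of a low and a
  high point appear only from \<open>p\<close> on (\<open>three_band_coloring\<close>). Starting with blue, one changes to red
  at \<open>2\<alpha> + k\<close>, and the red points have no sums below \<open>q\<close> (\<open>two_band_coloring\<close>).

  Upper bound: in a coloring of \<open>[\<alpha>, N]\<close> without solutions, the color of \<open>\<alpha>\<close> forces the colors of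
  finitely many further points, found by adding, subtracting and halving. If \<open>\<alpha>\<close> is red, points
  up to \<open>p\<close> give a contradiction (\<open>red_start_impossible\<close>). If \<open>\<alpha>\<close> is blue, points up to \<open>max p q\<close>
  do (\<open>blue_start_impossible\<close>). Halving uses solutions with \<open>x = y\<close>: a point \<open>z\<close> has the half
  \<open>(z - c) / 2\<close> in the red equation and \<open>(z - k) / 2\<close> in the blue one.\<close>

section \<open>Colorings without solutions\<close>

definition solution_free :: "(real \<Rightarrow> color) \<Rightarrow> real set \<Rightarrow> real \<Rightarrow> real \<Rightarrow> bool" where
  "solution_free f S c k \<longleftrightarrow>
     (\<nexists>t. mono_solution f Red S c t) \<and> (\<nexists>t. mono_solution f Blue S k t)"

lemma rado_forcing_iff_no_solution_free:
  "rado_forcing c k \<alpha> N \<longleftrightarrow> (\<nexists>f. solution_free f {\<alpha>..N} c k)"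
  unfolding rado_forcing_def solution_free_def by blast

lemma solution_free_iff:
  "solution_free f S c k \<longleftrightarrow>
     (\<forall>x\<in>S. \<forall>y\<in>S. x + y + c \<in> S \<longrightarrow> \<not> (f x = Red \<and> f y = Red \<and> f (x + y + c) = Red)) \<and>
     (\<forall>x\<in>S. \<forall>y\<in>S. x + y + k \<in> S \<longrightarrow> \<not> (f x = Blue \<and> f y = Blue \<and> f (x + y + k) = Blue))"
  unfolding solution_free_def mono_solution_def by auto

lemma solution_free_not_red:
  assumes "solution_free f S c k" "x + y + c = z" "x \<in> S" "y \<in> S" "z \<in> S"
  shows "\<not> (f x = Red \<and> f y = Red \<and> f z = Red)"
  using assms unfolding solution_free_iff by blast

lemma solution_free_not_blue:
  assumes "solution_free f S c k" "x + y + k = z" "x \<in> S" "y \<in> S" "z \<in> S"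
  shows "\<not> (f x = Blue \<and> f y = Blue \<and> f z = Blue)"
  using assms unfolding solution_free_iff by blast

section \<open>Extremal colorings\<close>

text \<open>Two low red points sum to less than \<open>4\<alpha> + 3c\<close>, which stays below the upper red band because
  \<open>c \<le> k\<close>; a low and a high one sum to at least \<open>5\<alpha> + 3c + k\<close>, beyond \<open>M\<close>.\<close>

lemma three_band_coloring:
  fixes c k \<alpha> :: real
  assumes "0 \<le> c" "0 \<le> \<alpha>" "c \<le> k" "M < k + 3 * c + 5 * \<alpha>"
  shows "solution_free
    (\<lambda>x. if 2 * \<alpha> + c \<le> x \<and> x < 4 * \<alpha> + 2 * c + k then Blue else Red) {\<alpha>..M} c k"
  using assms unfolding solution_free_iff by (auto split: if_splits)

lemma two_band_coloring:
  fixes c k \<alpha> :: real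
  assumes "M < 2 * k + c + 4 * \<alpha>"
  shows "solution_free (\<lambda>x. if x < 2 * \<alpha> + k then Blue else Red) {\<alpha>..M} c k"
  using assms unfolding solution_free_iff by (auto split: if_splits)

section \<open>Forced colors\<close>

text \<open>With \<open>\<alpha>\<close> red, \<open>5\<alpha> + 3c + k\<close> is blue, so its half with respect to the blue equation,
  \<open>(5\<alpha> + 3c) / 2\<close>, is red although it exceeds the blue point \<open>2\<alpha> + c\<close>. Subtracting
  \<open>\<alpha>\<close> yields a blue point \<open>(3\<alpha> + c) / 2\<close> whose blue double \<open>3\<alpha> + c + k\<close> is already blue.\<close>

lemma red_start_impossible:
  fixes c k \<alpha> :: real
  assumes free: "solution_free f {\<alpha>..N} c k"
    and nonneg: "0 \<le> c" "0 \<le> k" "0 \<le> \<alpha>"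
    and N: "k + 3 * c + 5 * \<alpha> \<le> N"
  shows "f \<alpha> \<noteq> Red"
proof
  assume a: "f \<alpha> = Red"
  note red = solution_free_not_red[OF free] and blue = solution_free_not_blue[OF free]
  have b1: "f (2 * \<alpha> + c) = Blue"
    using red[of \<alpha> \<alpha> "2 * \<alpha> + c"] a nonneg N by (cases "f (2 * \<alpha> + c)") auto
  have r1: "f (4 * \<alpha> + 2 * c + k) = Red"
    using blue[of "2 * \<alpha> + c" "2 * \<alpha> + c" "4 * \<alpha> + 2 * c + k"] b1 nonneg N
    by (cases "f (4 * \<alpha> + 2 * c + k)") auto
  have b2: "f (5 * \<alpha> + 3 * c + k) = Blue"
    using red[of \<alpha> "4 * \<alpha> + 2 * c + k" "5 * \<alpha> + 3 * c + k"] a r1 nonneg N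
    by (cases "f (5 * \<alpha> + 3 * c + k)") auto
  have b3: "f (3 * \<alpha> + c + k) = Blue"
    using red[of \<alpha> "3 * \<alpha> + c + k" "4 * \<alpha> + 2 * c + k"] a r1 nonneg N
    by (cases "f (3 * \<alpha> + c + k)") auto
  have r2: "f ((5 * \<alpha> + 3 * c) / 2) = Red"
    using blue[of "(5 * \<alpha> + 3 * c) / 2" "(5 * \<alpha> + 3 * c) / 2" "5 * \<alpha> + 3 * c + k"] b2 nonneg N
    by (cases "f ((5 * \<alpha> + 3 * c) / 2)") auto
  have "f ((3 * \<alpha> + c) / 2) = Blue"
    using red[of \<alpha> "(3 * \<alpha> + c) / 2" "(5 * \<alpha> + 3 * c) / 2"] a r2 nonneg N
    by (cases "f ((3 * \<alpha> + c) / 2)") (auto simp: field_simps)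
  then show False
    using blue[of "(3 * \<alpha> + c) / 2" "(3 * \<alpha> + c) / 2" "3 * \<alpha> + c + k"] b3 nonneg N by auto
qed

text \<open>With \<open>\<alpha>\<close> blue, two rounds of halving lead from \<open>4\<alpha> + 2k + c\<close> to the red point \<open>2\<alpha> + c\<close>.
  Moreover a red point \<open>r\<close> makes \<open>r + \<alpha> + c\<close> red: adding the red point \<open>2\<alpha> + k\<close> gives the blue
  point \<open>r + 2\<alpha> + k + c\<close>, from which \<open>\<alpha>\<close> is subtracted in the blue equation. Doing this twice from
  \<open>2\<alpha> + c\<close> reaches \<open>4\<alpha> + 3c\<close>, the red double of \<open>2\<alpha> + c\<close>.\<close>

lemma blue_start_impossible:
  fixes c k \<alpha> :: real
  assumes free: "solution_free f {\<alpha>..N} c k"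
    and nonneg: "0 \<le> c" "0 \<le> \<alpha>" "c \<le> k"
    and N: "k + 3 * c + 5 * \<alpha> \<le> N" "2 * k + c + 4 * \<alpha> \<le> N"
  shows "f \<alpha> \<noteq> Blue"
proof
  assume a: "f \<alpha> = Blue"
  note red = solution_free_not_red[OF free] and blue = solution_free_not_blue[OF free]
  have r1: "f (2 * \<alpha> + k) = Red"
    using blue[of \<alpha> \<alpha> "2 * \<alpha> + k"] a nonneg N by (cases "f (2 * \<alpha> + k)") auto
  have b1: "f (4 * \<alpha> + 2 * k + c) = Blue"
    using red[of "2 * \<alpha> + k" "2 * \<alpha> + k" "4 * \<alpha> + 2 * k + c"] r1 nonneg N
    by (cases "f (4 * \<alpha> + 2 * k + c)") auto
  have r2: "f (2 * \<alpha> + (k + c) / 2) = Red"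
    using blue[of "2 * \<alpha> + (k + c) / 2" "2 * \<alpha> + (k + c) / 2" "4 * \<alpha> + 2 * k + c"] b1 nonneg N
    by (cases "f (2 * \<alpha> + (k + c) / 2)") (auto simp: field_simps)
  have b2: "f (4 * \<alpha> + k + 2 * c) = Blue"
    using red[of "2 * \<alpha> + (k + c) / 2" "2 * \<alpha> + (k + c) / 2" "4 * \<alpha> + k + 2 * c"] r2 nonneg N
    by (cases "f (4 * \<alpha> + k + 2 * c)") (auto simp: field_simps)
  have r3: "f (2 * \<alpha> + c) = Red"
    using blue[of "2 * \<alpha> + c" "2 * \<alpha> + c" "4 * \<alpha> + k + 2 * c"] b2 nonneg N
    by (cases "f (2 * \<alpha> + c)") auto
  have step: "f (r + \<alpha> + c) = Red" if "f r = Red" "\<alpha> \<le> r" "r \<le> 3 * \<alpha> + 2 * c" for r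
  proof -
    have "f (r + 2 * \<alpha> + k + c) = Blue"
      using red[of r "2 * \<alpha> + k" "r + 2 * \<alpha> + k + c"] that r1 nonneg N
      by (cases "f (r + 2 * \<alpha> + k + c)") auto
    then show ?thesis
      using blue[of \<alpha> "r + \<alpha> + c" "r + 2 * \<alpha> + k + c"] that a nonneg N
      by (cases "f (r + \<alpha> + c)") auto
  qed
  have "f (3 * \<alpha> + 2 * c) = Red"
    using step[of "2 * \<alpha> + c"] r3 nonneg by (simp add: algebra_simps)
  then have "f (4 * \<alpha> + 3 * c) = Red"
    using step[of "3 * \<alpha> + 2 * c"] nonneg by (simp add: algebra_simps)
  then show False
    using red[of "2 * \<alpha> + c" "2 * \<alpha> + c" "4 * \<alpha> + 3 * c"] r3 nonneg N by auto
qed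

section \<open>The Rado number\<close>

lemma is_rado_min_max:
  fixes c k \<alpha> :: real
  assumes "0 \<le> c" "0 \<le> \<alpha>" "c \<le> k"
  shows "is_rado_min c k \<alpha> (max (k + 3 * c + 5 * \<alpha>) (2 * k + c + 4 * \<alpha>))"
    (is "is_rado_min c k \<alpha> ?N")
  unfolding is_rado_min_def
proof (intro conjI allI impI)
  show "\<alpha> \<le> ?N"
    using assms by linarith
  show "rado_forcing c k \<alpha> ?N"
    unfolding rado_forcing_iff_no_solution_free
  proof
    assume "\<exists>f. solution_free f {\<alpha>..?N} c k"
    then obtain f where "solution_free f {\<alpha>..?N} c k" ..
    then have "f \<alpha> \<noteq> Red" "f \<alpha> \<noteq> Blue"
      using red_start_impossible blue_start_impossible assms by auto
    then show False
      by (cases "f \<alpha>") auto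
  qed
  fix M
  assume "rado_forcing c k \<alpha> M"
  then show "?N \<le> M"
    unfolding rado_forcing_iff_no_solution_free
    using three_band_coloring[of c \<alpha> k M] two_band_coloring[of M k c \<alpha>] assms
    by (meson max.bounded_iff not_le)
qed

lemma R2_eq_if_is_rado_min:
  assumes "is_rado_min c k \<alpha> N"
  shows "R\<^sub>2 c k \<alpha> = ereal N"
proof -
  have "(THE N. is_rado_min c k \<alpha> N) = N"
    using assms by (intro the_equality) (auto simp: is_rado_min_def intro: antisym)
  then show ?thesis
    using assms unfolding R\<^sub>2_def by auto
qed

theorem theorem2:
  fixes c k \<alpha> :: real
  assumes "0 \<le> c" and "0 \<le> k" and "0 \<le> \<alpha>" and "c \<le> k"
  shows "R\<^sub>2 c k \<alpha> =
    (if k \<le> 2 * c + \<alpha> then ereal (k + 3 * c + 5 * \<alpha>) else ereal (2 * k + c + 4 * \<alpha>))"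
  using R2_eq_if_is_rado_min[OF is_rado_min_max[of c \<alpha> k]] assms by (simp add: max_def)

end
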